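(* Let $\eta>0$, $\mathcal{C}\in\mathbb{R}$, $\rho\in\mathbb{R}\setminus\{0\}$, $\beta\in\mathbb{R}$, and put $$a=2\sqrt{\tfrac\eta6},\qquad A=\left[\left(\tfrac{3\mathcal{C}}{\eta}\right)^2+\tfrac6\eta\left(\tfrac{\rho}{12}\right)^2\right]^{1/2},\qquad b=-a^3t+\beta .$$ Then $$u(x,t)=4\eta\,\frac{1-\frac{3\mathcal{C}}{\eta A}\cosh(ax+b)}{\left[\cosh(ax+b)-\frac{3}{\eta}\frac{\mathcal{C}}{A}\right]^2},\qquad v(x,t)=-\frac{\rho}{A}\,a\,\frac{\sinh(ax+b)}{\left[\cosh(ax+b)-\frac3\eta\frac{\mathcal{C}}{A}\right]^2}$$ are solutions, for $(x,t)\in\mathbb{R}^2$, of the system $$u_t+uu_x+u_{xxx}-vv_x=0,\qquad v_t+u_xv+v_xu+v_{xxx}=0.$$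
   Context: $u,v$ are real-valued functions of $(x,t)$; subscripts denote partial derivatives. The system is the case $\lambda=-1$ of $u_t+uu_x+u_{xxx}+\lambda vv_x=0$, $v_t+u_xv+v_xu+v_{xxx}=0$. *)

theory Defs
  imports "HOL-Analysis.Analysis"
begin

text \<open>A function \<open>f\<close> of space and time is applied as \<open>f x t\<close>.\<close>

definition pd_x :: "(real \<Rightarrow> real \<Rightarrow> real) \<Rightarrow> real \<Rightarrow> real \<Rightarrow> real" where
  "pd_x f = (\<lambda>x t. deriv (\<lambda>y. f y t) x)"

definition pd_t :: "(real \<Rightarrow> real \<Rightarrow> real) \<Rightarrow> real \<Rightarrow> real \<Rightarrow> real" where
  "pd_t f = (\<lambda>x t. deriv (\<lambda>s. f x s) t)"

text \<open>
  \<open>deriv\<close> is a total operator whose value is unspecified where the derivative does not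
  exist, so existence is required separately. The regularity is that of a classical solution of
  a system of order 1 in \<open>t\<close> and 3 in \<open>x\<close>: the derivatives \<open>f\<^sub>t\<close>, \<open>f\<^sub>x\<close>, \<open>f\<^sub>x\<^sub>x\<close> and
  \<open>f\<^sub>x\<^sub>x\<^sub>x\<close> exist on the whole plane and are, like \<open>f\<close>, jointly continuous there.
\<close>

definition classically_regular :: "(real \<Rightarrow> real \<Rightarrow> real) \<Rightarrow> bool" where
  "classically_regular f \<longleftrightarrow>
     (\<forall>x t. (\<lambda>s. f x s) differentiable (at t)) \<and>
     (\<forall>k<3. \<forall>x t. (\<lambda>y. (pd_x ^^ k) f y t) differentiable (at x)) \<and>
     continuous_on UNIV (\<lambda>(x, t). pd_t f x t) \<and>
     (\<forall>k\<le>3. continuous_on UNIV (\<lambda>(x, t). (pd_x ^^ k) f x t))"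

definition solves_system ::
    "(real \<Rightarrow> real \<Rightarrow> real) \<Rightarrow> (real \<Rightarrow> real \<Rightarrow> real) \<Rightarrow> bool" where
  "solves_system u v \<longleftrightarrow>
     classically_regular u \<and> classically_regular v \<and>
     (\<forall>x t. pd_t u x t + u x t * pd_x u x t + pd_x (pd_x (pd_x u)) x t
              - v x t * pd_x v x t = 0) \<and>
     (\<forall>x t. pd_t v x t + pd_x u x t * v x t + pd_x v x t * u x t
              + pd_x (pd_x (pd_x v)) x t = 0)"

end

theory Submission
  imports Defs
begin

text \<open>
  The system is the real form of the complex KdV equation for \<open>u + i v\<close>, and the solution is
  the travelling soliton with a complex phase. In terms of \<open>r = 1 / (cosh z - k)\<close> with
  \<open>z = a x - a\<^sup>3 t + \<beta>\<close>, \<open>k = 3 C / (\<eta> A)\<close> and \<open>q = 1 - k\<^sup>2\<close>, one has \<open>u = 6 a\<^sup>2 (q r\<^sup>2 - k r)\<close>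
  and \<open>v = (\<rho> a / A) r'\<close>. Since \<open>r'\<^sup>2 = r\<^sup>2 + 2 k r\<^sup>3 - q r\<^sup>4\<close> and
  \<open>r'' = r + 3 k r\<^sup>2 - 2 q r\<^sup>3\<close>, and the choice of \<open>A\<close> amounts to \<open>(\<rho> a / A)\<^sup>2 = 36 a\<^sup>4 q\<close>,
  both equations become polynomial identities in \<open>r\<close> and \<open>r'\<close>.
\<close>

text \<open>The factor \<open>h\<close> makes the class of such waves closed under differentiation:
  the result has the same shape, so the rule can be iterated up to third order.\<close>

lemma pd_x_travelling_wave:
  assumes "\<And>z. (F has_real_derivative F' z) (at z)"
  shows "pd_x (\<lambda>x t. h * F (a * x + (c * t + \<beta>))) = (\<lambda>x t. (h * a) * F' (a * x + (c * t + \<beta>)))"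
  unfolding pd_x_def
  by (intro ext DERIV_imp_deriv) (auto intro!: derivative_eq_intros DERIV_chain'[OF _ assms])

lemma pd_t_travelling_wave:
  assumes "\<And>z. (F has_real_derivative F' z) (at z)"
  shows "pd_t (\<lambda>x t. h * F (a * x + (c * t + \<beta>))) = (\<lambda>x t. (h * c) * F' (a * x + (c * t + \<beta>)))"
  unfolding pd_t_def
  by (intro ext DERIV_imp_deriv) (auto intro!: derivative_eq_intros DERIV_chain'[OF _ assms])

text \<open>Each derivative is again a travelling wave, with the next derivative of the profile, so
  regularity on the plane reduces to one variable. Only \<open>F3\<close> needs a continuity
  assumption; the lower profiles are differentiable.\<close>

lemma classically_regular_travelling_wave:
  assumes F: "\<And>z. (F has_real_derivative F1 z) (at z)"
    and F1: "\<And>z. (F1 has_real_derivative F2 z) (at z)"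
    and F2: "\<And>z. (F2 has_real_derivative F3 z) (at z)"
    and F3: "continuous_on UNIV F3"
  shows "classically_regular (\<lambda>x t. h * F (a * x + (c * t + \<beta>)))"
proof -
  let ?w = "\<lambda>(h::real) G x t. h * G (a * x + (c * t + \<beta>))"
  have diff: "(\<lambda>s. ?w h' G x s) differentiable (at t)" "(\<lambda>y. ?w h' G y t) differentiable (at x)"
    if "\<And>z. (G has_real_derivative G' z) (at z)" for G G' h' x t
    unfolding real_differentiable_def
    by (auto intro!: exI derivative_eq_intros DERIV_chain'[OF _ that])
  have cont: "continuous_on UNIV (\<lambda>(x, t). ?w h' G x t)" if "continuous_on UNIV G" for h' G
  proof -
    have "continuous_on UNIV (\<lambda>z. G (a * fst z + (c * snd z + \<beta>)))"
      by (rule continuous_on_compose2[OF that]) (auto intro!: continuous_intros)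
    then show ?thesis
      unfolding case_prod_beta by (rule continuous_on_mult[OF continuous_on_const])
  qed
  have C: "continuous_on UNIV F" "continuous_on UNIV F1" "continuous_on UNIV F2"
    by (rule DERIV_continuous_on, rule F F1 F2)+
  have pd: "(pd_x ^^ 0) (?w h F) = ?w h F" "(pd_x ^^ 1) (?w h F) = ?w (h * a) F1"
    "(pd_x ^^ 2) (?w h F) = ?w (h * a * a) F2" "(pd_x ^^ 3) (?w h F) = ?w (h * a * a * a) F3"
    by (simp_all add: numeral_eq_Suc pd_x_travelling_wave[OF F] pd_x_travelling_wave[OF F1]
        pd_x_travelling_wave[OF F2])
  have lt: "k = 0 \<or> k = 1 \<or> k = 2" if "k < 3" for k :: nat
    using that by auto
  have le: "k = 0 \<or> k = 1 \<or> k = 2 \<or> k = 3" if "k \<le> 3" for k :: nat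
    using that by auto
  show ?thesis
    unfolding classically_regular_def pd_t_travelling_wave[OF F]
  proof (intro conjI allI impI)
    show "(\<lambda>s. ?w h F x s) differentiable (at t)" for x t
      by (rule diff(1)[OF F])
    show "(\<lambda>y. (pd_x ^^ k) (?w h F) y t) differentiable (at x)" if "k < 3" for k x t
      using lt[OF that] by (elim disjE)
        (simp_all only: pd diff(2)[OF F] diff(2)[OF F1] diff(2)[OF F2])
    show "continuous_on UNIV (\<lambda>(x, t). ?w (h * c) F1 x t)"
      by (rule cont[OF C(2)])
    show "continuous_on UNIV (\<lambda>(x, t). (pd_x ^^ k) (?w h F) x t)" if "k \<le> 3" for k
      using le[OF that] by (elim disjE)
        (simp_all only: pd cont[OF C(1)] cont[OF C(2)] cont[OF C(3)] cont[OF F3])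
  qed
qed

text \<open>Here the hyperbolic functions are abstracted away: \<open>p2\<close> is the first
  integral, with constant 0, of the second-order equation for \<open>r\<close> given by
  \<open>r\<close> and \<open>p\<close>.\<close>

lemma soliton_solves_system:
  fixes r p :: "real \<Rightarrow> real" and a k q m \<beta> :: real
  assumes r: "\<And>z. (r has_real_derivative p z) (at z)"
    and p: "\<And>z. (p has_real_derivative r z + 3 * k * r z ^ 2 - 2 * q * r z ^ 3) (at z)"
    and p2: "\<And>z. p z ^ 2 = r z ^ 2 + 2 * k * r z ^ 3 - q * r z ^ 4"
    and q: "q = 1 - k ^ 2"
    and m: "m ^ 2 = 36 * a ^ 4 * q"
  shows "solves_system
    (\<lambda>x t. (6 * a ^ 2) * (\<lambda>z. q * r z ^ 2 - k * r z) (a * x + (- (a ^ 3) * t + \<beta>)))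
    (\<lambda>x t. m * p (a * x + (- (a ^ 3) * t + \<beta>)))"
proof -
  define U where "U z = q * r z ^ 2 - k * r z" for z
  define U1 where "U1 z = (2 * q * r z - k) * p z" for z
  \<comment> \<open>Differentiating \<open>U1\<close> produces a term \<open>2 q p^2\<close>;
    \<open>p2\<close> turns it into a polynomial in \<open>r\<close>. Hence \<open>U2\<close> is a
    polynomial in \<open>r\<close> alone and \<open>U3\<close> is one times
    \<open>p\<close>.\<close>
  define U2 where "U2 z = - k * r z + (4 * q - 3 * k ^ 2) * r z ^ 2 + 12 * q * k * r z ^ 3
      - 6 * q ^ 2 * r z ^ 4" for z
  define U3 where "U3 z = (- k + 2 * (4 * q - 3 * k ^ 2) * r z + 36 * q * k * r z ^ 2
      - 24 * q ^ 2 * r z ^ 3) * p z" for z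
  define V1 where "V1 z = r z + 3 * k * r z ^ 2 - 2 * q * r z ^ 3" for z
  define V2 where "V2 z = (1 + 6 * k * r z - 6 * q * r z ^ 2) * p z" for z
  define V3 where "V3 z = (6 * k - 12 * q * r z) * p z ^ 2
      + (1 + 6 * k * r z - 6 * q * r z ^ 2) * V1 z" for z
  have U: "(U has_real_derivative U1 z) (at z)" for z
    unfolding U_def U1_def
    by (rule derivative_eq_intros r refl)+ (simp add: algebra_simps)
  have U1: "(U1 has_real_derivative U2 z) (at z)" for z
  proof -
    have "(U1 has_real_derivative
        2 * q * p z ^ 2 + (2 * q * r z - k) * (r z + 3 * k * r z ^ 2 - 2 * q * r z ^ 3)) (at z)"
      unfolding U1_def
      by (rule derivative_eq_intros r p refl)+ (simp add: algebra_simps power2_eq_square)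
    also have "2 * q * p z ^ 2 + (2 * q * r z - k) * (r z + 3 * k * r z ^ 2 - 2 * q * r z ^ 3) = U2 z"
      unfolding U2_def p2 by algebra
    finally show ?thesis .
  qed
  have U2: "(U2 has_real_derivative U3 z) (at z)" for z
    unfolding U2_def U3_def
    by (rule derivative_eq_intros r refl)+ (simp add: algebra_simps)
  have V: "(p has_real_derivative V1 z) (at z)" for z
    unfolding V1_def by (rule p)
  have V1: "(V1 has_real_derivative V2 z) (at z)" for z
    unfolding V1_def V2_def
    by (rule derivative_eq_intros r refl)+ (simp add: algebra_simps)
  have V2: "(V2 has_real_derivative V3 z) (at z)" for z
    unfolding V2_def V3_def V1_def
    by (rule derivative_eq_intros r p refl)+ (simp add: algebra_simps power2_eq_square)
  have cont_r: "continuous_on UNIV r" and cont_p: "continuous_on UNIV p"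
    by (rule DERIV_continuous_on, rule r p)+
  have U3: "continuous_on UNIV U3"
    unfolding U3_def by (intro continuous_intros cont_r cont_p)
  have V3: "continuous_on UNIV V3"
    unfolding V3_def V1_def by (intro continuous_intros cont_r cont_p)
  note pd = pd_x_travelling_wave[OF U] pd_x_travelling_wave[OF U1] pd_x_travelling_wave[OF U2]
    pd_x_travelling_wave[OF V] pd_x_travelling_wave[OF V1] pd_x_travelling_wave[OF V2]
    pd_t_travelling_wave[OF U] pd_t_travelling_wave[OF V]
  \<comment> \<open>Every term carries a factor \<open>p z\<close>. The quadratic coupling sees
    \<open>m\<close> only through \<open>m^2\<close>, and \<open>m^2 = 36 a^4 q\<close> gives it the
    power \<open>a^5\<close> of the other terms. The coefficients are left as the rules
    \<open>pd\<close> produce them.\<close>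
  have eq_u: "6 * a ^ 2 * - (a ^ 3) * U1 z + 6 * a ^ 2 * U z * (6 * a ^ 2 * a * U1 z)
      + 6 * a ^ 2 * a * a * a * U3 z - m * p z * (m * a * V1 z) = 0" for z
  proof -
    have "m * p z * (m * a * V1 z) = m ^ 2 * (a * p z * V1 z)"
      by algebra
    then have *: "m * p z * (m * a * V1 z) = 36 * a ^ 4 * q * (a * p z * V1 z)"
      unfolding m .
    show ?thesis
      unfolding * unfolding U_def U1_def U3_def V1_def q by algebra
  qed
  \<comment> \<open>The equation is linear in \<open>v\<close> and reads
    \<open>v_t + (u v)_x + v_xxx = 0\<close>. Since \<open>V2 = (1 - 6 U) p\<close>, it is
    \<open>m a^3\<close> times the derivative of the identity
    \<open>- p + 6 U p + V2 = 0\<close>.\<close>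
  have eq_v: "m * - (a ^ 3) * V1 z + 6 * a ^ 2 * a * U1 z * (m * p z)
      + m * a * V1 z * (6 * a ^ 2 * U z) + m * a * a * a * V3 z = 0" for z
  proof -
    have *: "6 * a ^ 2 * a * U1 z * (m * p z) = 6 * m * a ^ 3 * (2 * q * r z - k) * p z ^ 2"
      unfolding U1_def by algebra
    show ?thesis
      unfolding * unfolding U_def V1_def V3_def p2 by algebra
  qed
  show ?thesis
    unfolding solves_system_def U_def[symmetric] pd
    using classically_regular_travelling_wave[OF U U1 U2 U3]
      classically_regular_travelling_wave[OF V V1 V2 V3] eq_u eq_v
    by blast
qed

theorem proposition1:
  fixes \<eta> C \<rho> \<beta> a A :: real
    and b :: "real \<Rightarrow> real"
    and u v :: "real \<Rightarrow> real \<Rightarrow> real"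
  assumes "\<eta> > 0"
    and "\<rho> \<noteq> 0"
    and "a = 2 * sqrt (\<eta> / 6)"
    and "A = sqrt ((3 * C / \<eta>)^2 + 6 / \<eta> * (\<rho> / 12)^2)"
    and "b = (\<lambda>t. - (a^3) * t + \<beta>)"
    and "u = (\<lambda>x t. 4 * \<eta> * ((1 - 3 * C / (\<eta> * A) * cosh (a * x + b t))
                 / (cosh (a * x + b t) - 3 / \<eta> * (C / A))^2))"
    and "v = (\<lambda>x t. - (\<rho> / A) * a * (sinh (a * x + b t)
                 / (cosh (a * x + b t) - 3 / \<eta> * (C / A))^2))"
  shows "solves_system u v"
proof -
  define k where "k = 3 * C / (\<eta> * A)"
  define q where "q = 1 - k ^ 2"
  define r where "r z = 1 / (cosh z - k)" for z :: real
  define p where "p z = - (sinh z * r z ^ 2)" for z :: real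
  have \<eta>: "\<eta> \<noteq> 0"
    using assms(1) by simp
  have pos: "0 < 6 / \<eta> * (\<rho> / 12) ^ 2"
    using assms(1,2) by simp
  have A2: "A ^ 2 = (3 * C / \<eta>) ^ 2 + 6 / \<eta> * (\<rho> / 12) ^ 2"
    using assms(4) pos by simp
  have A: "A > 0"
    unfolding assms(4) using pos by (simp add: add_nonneg_pos)
  have a2: "a ^ 2 = 2 * \<eta> / 3"
    using assms(1,3) by (simp add: power_mult_distrib)
  \<comment> \<open>Dividing the formula for \<open>A^2\<close> by \<open>A^2\<close> splits 1 into
    \<open>k^2\<close> and this quotient.\<close>
  have q_eq: "q = 6 / \<eta> * (\<rho> / 12) ^ 2 / A ^ 2"
  proof -
    have "k = 3 * C / \<eta> / A"
      unfolding k_def by simp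
    then have "k ^ 2 = (3 * C / \<eta>) ^ 2 / A ^ 2"
      by (simp only: power_divide)
    moreover have "A ^ 2 / A ^ 2 = 1"
      using A by simp
    ultimately have "q = (A ^ 2 - (3 * C / \<eta>) ^ 2) / A ^ 2"
      unfolding q_def diff_divide_distrib by (simp only:)
    moreover have "A ^ 2 - (3 * C / \<eta>) ^ 2 = 6 / \<eta> * (\<rho> / 12) ^ 2"
      using A2 by linarith
    ultimately show ?thesis
      by (simp only:)
  qed
  \<comment> \<open>Here \<rho> \<noteq> 0 enters, through \<open>pos\<close>: it forces
    \<open>k < 1 \<le> cosh z\<close>, so the denominators vanish nowhere and the solution is
    global.\<close>
  have "k ^ 2 < 1"
  proof -
    have "q > 0"
      unfolding q_eq using pos A by (intro divide_pos_pos) auto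
    then show ?thesis
      unfolding q_def by simp
  qed
  then have "k < 1"
    using abs_square_less_1 by force
  then have D: "cosh z - k \<noteq> 0" for z :: real
    using cosh_real_ge_1[of z] by linarith
  \<comment> \<open>Multiplied by powers of \<open>r\<close>, \<open>cosh\<close> and the square of
    \<open>sinh\<close> become polynomials in \<open>r\<close>; the derivatives below are grouped
    into exactly these products.\<close>
  have cosh_eq: "cosh z * r z = 1 + k * r z" for z
    unfolding r_def using D[of z] by (simp add: field_simps)
  have sinh_eq: "sinh z ^ 2 * r z ^ 2 = 1 + 2 * k * r z - q * r z ^ 2" for z
  proof -
    have "sinh z ^ 2 * r z ^ 2 = (cosh z * r z) ^ 2 - r z ^ 2"
      unfolding sinh_square_eq by algebra
    then show ?thesis
      unfolding cosh_eq q_def by algebra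
  qed
  have r: "(r has_real_derivative p z) (at z)" for z
    unfolding r_def p_def
    by (rule derivative_eq_intros refl D)+ (simp add: power2_eq_square)
  have p: "(p has_real_derivative r z + 3 * k * r z ^ 2 - 2 * q * r z ^ 3) (at z)" for z
  proof -
    have "(p has_real_derivative 2 * (sinh z ^ 2 * r z ^ 2) * r z - cosh z * r z * r z) (at z)"
      unfolding p_def
      by (rule derivative_eq_intros refl r)+ (simp add: p_def power2_eq_square algebra_simps)
    also have "2 * (sinh z ^ 2 * r z ^ 2) * r z - cosh z * r z * r z
        = r z + 3 * k * r z ^ 2 - 2 * q * r z ^ 3"
      unfolding sinh_eq cosh_eq by algebra
    finally show ?thesis .
  qed
  have p2: "p z ^ 2 = r z ^ 2 + 2 * k * r z ^ 3 - q * r z ^ 4" for z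
  proof -
    have "p z ^ 2 = (sinh z ^ 2 * r z ^ 2) * r z ^ 2"
      unfolding p_def by algebra
    then show ?thesis
      unfolding sinh_eq by algebra
  qed
  \<comment> \<open>As \<open>a^2 = 2 \<eta> / 3\<close>, the factor
    \<open>36 a^4 * 6 / (144 \<eta>)\<close> equals \<open>a^2\<close>.\<close>
  have m: "(\<rho> / A * a) ^ 2 = 36 * a ^ 4 * q"
  proof -
    have a4: "a ^ 4 = (2 * \<eta> / 3) ^ 2"
      unfolding a2[symmetric] by simp
    show ?thesis
      unfolding q_eq a4 power_mult_distrib a2 using A \<eta>
      by (simp add: field_simps power2_eq_square)
  qed
  have k': "3 / \<eta> * (C / A) = k"
    unfolding k_def by simp
  \<comment> \<open>The prefactor is \<open>4 \<eta> = 6 a^2\<close>, and \<open>cosh_eq\<close>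
    turns the quotient into \<open>r^2 - k (1 + k r) r\<close>.\<close>
  have u: "u = (\<lambda>x t. (6 * a ^ 2) * (\<lambda>z. q * r z ^ 2 - k * r z) (a * x + (- (a ^ 3) * t + \<beta>)))"
  proof -
    have "(1 - k * cosh z) / (cosh z - k) ^ 2 = q * r z ^ 2 - k * r z" for z
    proof -
      have "(1 - k * cosh z) / (cosh z - k) ^ 2 = r z ^ 2 - k * (cosh z * r z) * r z"
        unfolding r_def by (simp add: power2_eq_square diff_divide_distrib)
      then show ?thesis
        unfolding cosh_eq q_def by algebra
    qed
    then show ?thesis
      unfolding assms(5,6) k' k_def[symmetric] a2 by simp
  qed
  have v: "v = (\<lambda>x t. (\<rho> / A * a) * p (a * x + (- (a ^ 3) * t + \<beta>)))"
    unfolding assms(5,7) k' p_def r_def by (simp add: power_divide)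
  show ?thesis
    unfolding u v by (rule soliton_solves_system[OF r p p2 q_def m])
qed

end
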